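(* Let $n\ge 1$ be an integer and let $A,B$ be complex-valued random variables with $\mathbb{E}[|A|^n]<\infty$ and $\mathbb{E}[|B|^n]<\infty$. Assume that $\mathbb{E}[A^k]\neq 1$ for all $k=1,\dots,n$. Then there exists exactly one finite free perpetuity polynomial of order $n$ generated by $(A,B)$.
   Context: All random variables are complex-valued and have finite absolute moments up to order $n$. For random variables $X,Y$ write $X\stackrel{d}{=}_n Y$ if $\mathbb{E}[X^k]=\mathbb{E}[Y^k]$ for all $k=1,\dots,n$. A random variable $X$ and a pair $(A,B)$ are called affinely $n$-independent if $\mathbb{E}[X^iA^iB^j]=\mathbb{E}[X^i]\,\mathbb{E}[A^iB^j]$ for all integers $i,j\ge 0$ with $i+j\le n$. A polynomial $p$ is a finite free perpetuity polynomial of order $n$ generated by $(A,B)$ if $p(z)=\mathbb{E}[(z-X)^n]$ for some random variable $X$ with finite moments up to order $n$ such that $X\stackrel{d}{=}_n AX+B$ and $X$ and $(A,B)$ are affinely $n$-independent. The underlying probability space is assumed rich enough; equivalently, only the joint law of $(X,A,B)$ matters, so $(X,A,B)$ may be realized on any probability space on which $(A,B)$ has its given joint law. *)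

theory Defs
  imports "HOL-Probability.Probability" "HOL-Computational_Algebra.Polynomial"
begin

definition finite_moments :: "'a measure \<Rightarrow> nat \<Rightarrow> ('a \<Rightarrow> complex) \<Rightarrow> bool" where
  "finite_moments M n X \<longleftrightarrow>
     X \<in> borel_measurable M \<and> (\<forall>k\<le>n. integrable M (\<lambda>\<omega>. norm (X \<omega>) ^ k))"

text \<open>Only the holomorphic moments are compared. Finiteness of the absolute moments of both
  variables is part of the relation, so that no value \<open>0\<close> of the Bochner integral of a
  non-integrable function enters.\<close>

definition moments_eq ::
    "'a measure \<Rightarrow> nat \<Rightarrow> ('a \<Rightarrow> complex) \<Rightarrow> ('a \<Rightarrow> complex) \<Rightarrow> bool" where
  "moments_eq M n X Y \<longleftrightarrow>
     finite_moments M n X \<and> finite_moments M n Y \<and>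
     (\<forall>k\<in>{1..n}. (\<integral>\<omega>. X \<omega> ^ k \<partial>M) = (\<integral>\<omega>. Y \<omega> ^ k \<partial>M))"

text \<open>The integrability clause says that the mixed expectation on the left-hand side exists.
  For \<open>X\<close>, \<open>B\<close> and \<open>A X + B\<close> with finite absolute moments up to order \<open>n\<close> it is automatic, by
  Hoelder's inequality.\<close>

definition affinely_independent ::
    "'a measure \<Rightarrow> nat \<Rightarrow> ('a \<Rightarrow> complex) \<Rightarrow> ('a \<Rightarrow> complex) \<Rightarrow> ('a \<Rightarrow> complex) \<Rightarrow> bool" where
  "affinely_independent M n X A B \<longleftrightarrow>
     (\<forall>i j. i + j \<le> n \<longrightarrow>
        integrable M (\<lambda>\<omega>. X \<omega> ^ i * A \<omega> ^ i * B \<omega> ^ j) \<and>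
        (\<integral>\<omega>. X \<omega> ^ i * A \<omega> ^ i * B \<omega> ^ j \<partial>M) =
        (\<integral>\<omega>. X \<omega> ^ i \<partial>M) * (\<integral>\<omega>. A \<omega> ^ i * B \<omega> ^ j \<partial>M))"

definition joint_law ::
    "'a measure \<Rightarrow> ('a \<Rightarrow> complex) \<Rightarrow> ('a \<Rightarrow> complex) \<Rightarrow> (complex \<times> complex) measure" where
  "joint_law M A B = distr M borel (\<lambda>\<omega>. (A \<omega>, B \<omega>))"

text \<open>The triple \<open>(X, A', B')\<close> lives on the probability space \<open>N\<close>, and \<open>(A', B')\<close> is a copy of
  the pair \<open>(A, B)\<close> given on \<open>M\<close>.\<close>

definition perpetuity_realization ::
    "'b measure \<Rightarrow> ('b \<Rightarrow> complex) \<Rightarrow> ('b \<Rightarrow> complex) \<Rightarrow> ('b \<Rightarrow> complex) \<Rightarrow>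
     'a measure \<Rightarrow> nat \<Rightarrow> ('a \<Rightarrow> complex) \<Rightarrow> ('a \<Rightarrow> complex) \<Rightarrow> complex poly \<Rightarrow> bool" where
  "perpetuity_realization N X A' B' M n A B p \<longleftrightarrow>
     prob_space N \<and>
     A' \<in> borel_measurable N \<and> B' \<in> borel_measurable N \<and>
     joint_law N A' B' = joint_law M A B \<and>
     moments_eq N n X (\<lambda>\<omega>. A' \<omega> * X \<omega> + B' \<omega>) \<and>
     affinely_independent N n X A' B' \<and>
     (\<forall>z. poly p z = (\<integral>\<omega>. (z - X \<omega>) ^ n \<partial>N))"

text \<open>One cannot quantify over the type of the sample space of \<open>(X, A', B')\<close>. The type
  \<open>complex \<times> complex \<times> complex\<close>, which carries every law of a complex triple, loses no
  generality: see the lemma below.\<close>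

definition finite_free_perpetuity_poly ::
    "'a measure \<Rightarrow> nat \<Rightarrow> ('a \<Rightarrow> complex) \<Rightarrow> ('a \<Rightarrow> complex) \<Rightarrow> complex poly \<Rightarrow> bool" where
  "finite_free_perpetuity_poly M n A B p \<longleftrightarrow>
     (\<exists>(N :: (complex \<times> complex \<times> complex) measure) X A' B'.
        perpetuity_realization N X A' B' M n A B p)"

lemma finite_free_perpetuity_polyI:
  fixes N :: "'b measure"
  assumes "perpetuity_realization N X A' B' M n A B p"
  shows "finite_free_perpetuity_poly M n A B p"
proof -
  let ?T = "\<lambda>\<omega>. (X \<omega>, A' \<omega>, B' \<omega>)"
  let ?L = "distr N borel ?T"
  let ?a = "\<lambda>t::complex \<times> complex \<times> complex. fst (snd t)"
  let ?b = "\<lambda>t::complex \<times> complex \<times> complex. snd (snd t)"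
  note r = assms[unfolded perpetuity_realization_def]
  interpret N: prob_space N using r by blast
  have [measurable]: "X \<in> borel_measurable N" "A' \<in> borel_measurable N" "B' \<in> borel_measurable N"
    using r by (auto simp: moments_eq_def finite_moments_def)
  have T [measurable]: "?T \<in> borel_measurable N"
    by measurable
  have [measurable]: "fst \<in> borel_measurable (borel :: (complex \<times> complex \<times> complex) measure)"
    "?a \<in> borel_measurable borel" "?b \<in> borel_measurable borel"
    by (intro borel_measurable_continuous_onI continuous_intros)+
  have pair: "(\<lambda>t. (?a t, ?b t)) \<in> borel_measurable borel"
    by measurable
  have law: "joint_law ?L ?a ?b = joint_law N A' B'"
    unfolding joint_law_def by (subst distr_distr) (simp_all only: pair T comp_def fst_conv snd_conv)
  have fm: "finite_moments ?L n f \<longleftrightarrow> finite_moments N n (\<lambda>\<omega>. f (?T \<omega>))"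
    if [measurable]: "f \<in> borel_measurable borel" for f
    unfolding finite_moments_def by (simp add: integrable_distr_eq)
  have me: "moments_eq ?L n f g \<longleftrightarrow> moments_eq N n (\<lambda>\<omega>. f (?T \<omega>)) (\<lambda>\<omega>. g (?T \<omega>))"
    if [measurable]: "f \<in> borel_measurable borel" "g \<in> borel_measurable borel" for f g
    unfolding moments_eq_def by (simp add: integral_distr fm)
  have ai: "affinely_independent ?L n fst ?a ?b \<longleftrightarrow> affinely_independent N n X A' B'"
    unfolding affinely_independent_def by (simp add: integral_distr integrable_distr_eq)
  have "perpetuity_realization ?L fst ?a ?b M n A B p"
    unfolding perpetuity_realization_def
    using r by (simp add: law fm me ai N.prob_space_distr integral_distr)
  then show ?thesis
    unfolding finite_free_perpetuity_poly_def by blast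
qed

end

theory Submission imports Defs begin

text \<open>Expanding \<open>(A X + B)\<^sup>k\<close> binomially, affine independence turns \<open>E[X\<^sup>k] = E[(A X + B)\<^sup>k]\<close> into a
  triangular recursion for the moments of \<open>X\<close>, solvable exactly because \<open>E[A\<^sup>k] \<noteq> 1\<close>. Thus the
  moments of \<open>X\<close> up to order \<open>n\<close>, and with them \<open>E[(z - X)\<^sup>n]\<close>, are determined by \<open>(A, B)\<close>.
  Conversely every complex sequence \<open>1, m\<^sub>1, \<dots>, m\<^sub>n\<close> consists of the moments of a variable supported
  on the \<open>(2n + 1)\<close>-st roots of unity scaled by a large radius \<open>R\<close>: perturb the uniform weights by
  the trigonometric polynomial with the small Fourier coefficients \<open>m\<^sub>k / R\<^sup>k\<close>. Take such a variable
  independent of \<open>(A, B)\<close>, on a product space.\<close>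

subsection \<open>Prescribed holomorphic moments\<close>

text \<open>Orthogonality of the characters of a cyclic group: the sum is geometric, its ratio
  \<open>?q\<close> satisfies \<open>?q ^ N = 1\<close>, and \<open>?q = 1\<close> would force
  \<open>N\<close> to divide \<open>d\<close>.\<close>

lemma sum_cis_eq_0:
  fixes d :: int and N :: nat
  assumes "\<bar>d\<bar> < int N" "d \<noteq> 0"
  shows "(\<Sum>j<N. cis (2 * pi * of_int d * real j / real N)) = 0"
proof -
  let ?q = "cis (2 * pi * of_int d / real N)"
  have N: "N > 0" using assms by (cases N) auto
  have pw: "cis (2 * pi * of_int d * real j / real N) = ?q ^ j" for j
    by (simp add: Complex.DeMoivre mult_ac)
  have one: "?q ^ N = 1"
    using N by (simp add: Complex.DeMoivre cis_multiple_2pi)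
  have "?q \<noteq> 1"
  proof
    assume "?q = 1"
    then have "cos (2 * pi * of_int d / real N) = 1" by (simp add: complex_eq_iff)
    then obtain k :: int where "2 * pi * of_int d / real N = of_int k * (2 * pi)"
      by (auto simp: cos_one_2pi_int)
    then have "real_of_int d = of_int k * real N" using N by (simp add: field_simps)
    then have "d = k * int N" by (metis of_int_eq_iff of_int_mult of_int_of_nat_eq)
    then have "int N dvd d" by simp
    then show False using assms zdvd_imp_le[of "int N" "\<bar>d\<bar>"] by auto
  qed
  then show ?thesis unfolding pw using geometric_sum[of ?q N] one by simp
qed

text \<open>On a circle of radius \<open>R\<close> the \<open>l\<close>-th moment is
  \<open>R ^ l\<close> times a Fourier coefficient of the weights. Only powers without conjugates
  are prescribed, so the one obstruction is nonnegativity of the weights, and a large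
  \<open>R\<close> makes the required coefficients small.\<close>

lemma exists_prob_space_moments:
  fixes m :: "nat \<Rightarrow> complex" and n :: nat
  assumes m0: "m 0 = 1"
  obtains D :: "nat measure" and X :: "nat \<Rightarrow> complex"
  where "prob_space D" "finite_moments D n X" "\<And>l. l \<le> n \<Longrightarrow> (\<integral>j. X j ^ l \<partial>D) = m l"
proof -
  \<comment> \<open>Large enough to exclude aliasing: all frequencies \<open>l - k\<close> and
    \<open>l + k\<close> with \<open>l\<close>, \<open>k\<close> \<le> \<open>n\<close> have
    absolute value at most \<open>2 * n\<close>.\<close>
  define N where "N = 2 * n + 1"
  \<comment> \<open>Chosen so that the norms of the \<open>c k\<close> sum to at most 1/2, hence
    twice a real part stays above -1. The summand 1 gives \<open>R\<close> \<le>
    \<open>R ^ k\<close>.\<close>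
  define R where "R = 1 + 2 * (\<Sum>k=1..n. norm (m k))"
  define c where "c k = m k / of_real R ^ k" for k
  define e where "e d j = cis (2 * pi * of_int d * real j / real N)" for d :: int and j :: nat
  \<comment> \<open>Taking real parts makes the weights real at the cost of the conjugate
    frequencies, which the moments up to order \<open>n\<close> do not see.\<close>
  define w where "w j = (1 + 2 * Re (\<Sum>k=1..n. c k * e (- int k) j)) / real N" for j
  define X where "X j = of_real R * e 1 j" for j
  have N: "N > 0" by (simp add: N_def)
  have R: "R \<ge> 1" unfolding R_def by (simp add: sum_nonneg)
  have sum_e: "(\<Sum>j<N. e d j) = (if d = 0 then of_nat N else 0)" if "\<bar>d\<bar> < int N" for d
    using sum_cis_eq_0[OF that] by (auto simp: e_def)
  have e_mult: "e a j * e b j = e (a + b) j" for a b j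
    by (simp add: e_def cis_mult add_divide_distrib ring_distribs)
  have e_cnj: "cnj (e a j) = e (- a) j" for a j
    by (simp add: e_def cis_cnj)
  have e_pow: "e 1 j ^ l = e (int l) j" for l j
    by (simp add: e_def Complex.DeMoivre mult_ac)
  have c_le: "norm (c k) \<le> norm (m k) / R" if "k \<ge> 1" for k
  proof -
    have "R \<le> R ^ k" using R that by (simp add: self_le_power)
    then show ?thesis using R
      by (auto simp: c_def norm_divide norm_power intro!: divide_left_mono mult_pos_pos)
  qed
  have w_nonneg: "w j \<ge> 0" for j
  proof -
    have "norm (\<Sum>k=1..n. c k * e (- int k) j) \<le> (\<Sum>k=1..n. norm (m k) / R)"
      by (rule sum_norm_le) (use c_le in \<open>auto simp: norm_mult e_def\<close>)
    also have "\<dots> = (\<Sum>k=1..n. norm (m k)) / R" by (simp add: sum_divide_distrib)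
    also have "\<dots> \<le> 1 / 2" using R by (simp add: R_def divide_simps)
    finally have "- Re (\<Sum>k=1..n. c k * e (- int k) j) \<le> 1 / 2"
      using abs_Re_le_cmod[of "\<Sum>k=1..n. c k * e (- int k) j"] by linarith
    then show ?thesis unfolding w_def by (intro divide_nonneg_nonneg) auto
  qed
  have w_eq: "of_real (w j) =
      (1 + (\<Sum>k=1..n. c k * e (- int k) j) + (\<Sum>k=1..n. cnj (c k) * e (int k) j)) / of_nat N" for j
  proof -
    let ?s = "\<Sum>k=1..n. c k * e (- int k) j"
    have "complex_of_real (2 * Re ?s) = ?s + cnj ?s" by (rule complex_add_cnj[symmetric])
    moreover have "cnj ?s = (\<Sum>k=1..n. cnj (c k) * e (int k) j)" by (simp add: e_cnj)
    moreover have "complex_of_real (w j) = (1 + complex_of_real (2 * Re ?s)) / of_nat N"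
      unfolding w_def by simp
    ultimately show ?thesis by (simp add: add.assoc)
  qed
  \<comment> \<open>Frequency 0 is separate because it comes from the constant term 1 of
    \<open>w\<close>; the perturbation starts at \<open>k = 1\<close>.\<close>
  have fourier: "(\<Sum>j<N. of_real (w j) * e (int l) j) = (if l = 0 then 1 else c l)" if l: "l \<le> n" for l
  proof -
    have "(\<Sum>j<N. of_real (w j) * e (int l) j) =
       (\<Sum>j<N. e (int l) j + (\<Sum>k=1..n. c k * e (int l - int k) j)
          + (\<Sum>k=1..n. cnj (c k) * e (int l + int k) j)) / of_nat N"
      unfolding w_eq sum_divide_distrib
      by (intro sum.cong refl)
        (simp add: ring_distribs sum_distrib_right e_mult mult.assoc add.commute)
    also have "(\<Sum>j<N. e (int l) j + (\<Sum>k=1..n. c k * e (int l - int k) j)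
          + (\<Sum>k=1..n. cnj (c k) * e (int l + int k) j)) =
       (\<Sum>j<N. e (int l) j) + (\<Sum>k=1..n. c k * (\<Sum>j<N. e (int l - int k) j))
          + (\<Sum>k=1..n. cnj (c k) * (\<Sum>j<N. e (int l + int k) j))"
      by (simp add: sum.distrib sum_distrib_left sum.swap[of _ "{..<N}"])
    \<comment> \<open>The conjugate part contributes nothing, as \<open>l + k\<close> lies strictly
      between 0 and \<open>N\<close>.\<close>
    also have "(\<Sum>k=1..n. cnj (c k) * (\<Sum>j<N. e (int l + int k) j)) = 0"
      using l by (intro sum.neutral ballI) (subst sum_e, auto simp: N_def)
    also have "(\<Sum>k=1..n. c k * (\<Sum>j<N. e (int l - int k) j)) =
        (\<Sum>k=1..n. if k = l then c k * of_nat N else 0)"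
      using l by (intro sum.cong refl) (subst sum_e, auto simp: N_def)
    also have "\<dots> = (if l = 0 then 0 else c l * of_nat N)"
      using l by (auto simp: sum.delta)
    also have "(\<Sum>j<N. e (int l) j) = (if l = 0 then of_nat N else 0)"
      using l by (subst sum_e) (auto simp: N_def)
    finally show ?thesis using N by auto
  qed
  \<comment> \<open>The total mass is the Fourier coefficient at frequency 0.\<close>
  have "complex_of_real (\<Sum>j<N. w j) = 1" using fourier[of 0] by (simp add: e_def)
  then have w_sum: "(\<Sum>j<N. w j) = 1" by (metis of_real_eq_1_iff)
  define D where "D = point_measure {..<N} w"
  have meas: "f \<in> borel_measurable D" for f :: "nat \<Rightarrow> complex"
    unfolding D_def by simp
  show thesis
  proof
    show "prob_space D" unfolding D_def
      by (rule prob_space_point_measure) (use w_nonneg w_sum in auto)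
    show "finite_moments D n X" unfolding finite_moments_def
      using meas w_nonneg by (auto simp: D_def intro!: integrable_point_measure_finite)
    fix l assume l: "l \<le> n"
    have "(\<integral>j. X j ^ l \<partial>D) = (\<Sum>j<N. w j *\<^sub>R X j ^ l)"
      unfolding D_def by (rule lebesgue_integral_point_measure_finite) (use w_nonneg in auto)
    also have "\<dots> = of_real R ^ l * (\<Sum>j<N. of_real (w j) * e (int l) j)"
      by (simp add: X_def power_mult_distrib e_pow scaleR_conv_of_real sum_distrib_left mult_ac)
    also have "\<dots> = m l"
      using R by (simp add: fourier[OF l] m0 c_def)
    finally show "(\<integral>j. X j ^ l \<partial>D) = m l" .
  qed
qed

subsection \<open>The moment recursion\<close>

text \<open>\<open>E i j\<close> stands for the expectation of \<open>A ^ i * B ^ j\<close>. The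
  recursion is the moment equation solved for its top term. Where \<open>E k 0 = 1\<close>, division
  by zero yields the default 0; for \<open>1\<close> \<le> \<open>k\<close> \<le> \<open>n\<close>
  this case is excluded in the application.\<close>

function perpetuity_moment :: "(nat \<Rightarrow> nat \<Rightarrow> complex) \<Rightarrow> nat \<Rightarrow> complex" where
  "perpetuity_moment E k = (if k = 0 then 1 else
     (\<Sum>i<k. of_nat (k choose i) * (perpetuity_moment E i * E i (k - i))) / (1 - E k 0))"
  by auto
termination by (relation "Wellfounded.measure snd") auto

declare perpetuity_moment.simps [simp del]

lemma perpetuity_moment_0 [simp]: "perpetuity_moment E 0 = 1"
  by (simp add: perpetuity_moment.simps)

text \<open>The summand \<open>i = k\<close> is \<open>m k * E k 0\<close>; moved to the left it
  leaves \<open>m k\<close> with the factor \<open>1 - E k 0\<close>, which can be divided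
  out.\<close>

lemma moment_recursion_step_iff:
  fixes E :: "nat \<Rightarrow> nat \<Rightarrow> complex"
  assumes "E k 0 \<noteq> 1"
  shows "m k = (\<Sum>i\<le>k. of_nat (k choose i) * (m i * E i (k - i))) \<longleftrightarrow>
    m k = (\<Sum>i<k. of_nat (k choose i) * (m i * E i (k - i))) / (1 - E k 0)"
  using assms by (simp add: lessThan_Suc_atMost[symmetric] divide_simps) (auto simp: algebra_simps)

lemma perpetuity_moment_recursion:
  assumes "k \<ge> 1" "E k 0 \<noteq> 1"
  shows "perpetuity_moment E k =
    (\<Sum>i\<le>k. of_nat (k choose i) * (perpetuity_moment E i * E i (k - i)))"
  unfolding moment_recursion_step_iff[of E k "perpetuity_moment E", OF assms(2)]
  using assms(1) by (subst perpetuity_moment.simps) simp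

lemma perpetuity_moment_unique:
  assumes "m 0 = 1" and ne: "\<And>k. k \<in> {1..n} \<Longrightarrow> E k 0 \<noteq> 1"
    and rec: "\<And>k. k \<in> {1..n} \<Longrightarrow> m k = (\<Sum>i\<le>k. of_nat (k choose i) * (m i * E i (k - i)))"
    and "k \<le> n"
  shows "m k = perpetuity_moment E k"
  using \<open>k \<le> n\<close>
proof (induction k rule: less_induct)
  case (less k)
  show ?case
  proof (cases "k = 0")
    case False
    with less.prems have k: "k \<in> {1..n}" by simp
    have "m k = (\<Sum>i<k. of_nat (k choose i) * (m i * E i (k - i))) / (1 - E k 0)"
      using rec[OF k] moment_recursion_step_iff[of E k m] ne[OF k] by simp
    also have "\<dots> = (\<Sum>i<k. of_nat (k choose i) * (perpetuity_moment E i * E i (k - i))) / (1 - E k 0)"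
      using less by simp
    finally show ?thesis using False by (subst perpetuity_moment.simps) simp
  qed (simp add: assms(1))
qed

subsection \<open>Moments of affine images\<close>

text \<open>After the triangle inequality, the binomial terms are the norms of exactly those mixed
  products whose integrability is part of affine independence.\<close>

lemma affinely_independent_integrable_affine:
  assumes ai: "affinely_independent N n X A B" and k: "k \<le> n"
    and [measurable]: "X \<in> borel_measurable N" "A \<in> borel_measurable N" "B \<in> borel_measurable N"
  shows "integrable N (\<lambda>\<omega>. norm (A \<omega> * X \<omega> + B \<omega>) ^ k)"
proof (rule Bochner_Integration.integrable_bound)
  show "integrable N (\<lambda>\<omega>. \<Sum>i\<le>k. of_nat (k choose i) * norm (X \<omega> ^ i * A \<omega> ^ i * B \<omega> ^ (k - i)))"
    using ai k unfolding affinely_independent_def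
    by (intro Bochner_Integration.integrable_sum integrable_mult_right integrable_norm) auto
  have "norm (A \<omega> * X \<omega> + B \<omega>) ^ k \<le>
     (\<Sum>i\<le>k. of_nat (k choose i) * norm (X \<omega> ^ i * A \<omega> ^ i * B \<omega> ^ (k - i)))" for \<omega>
  proof -
    have "norm (A \<omega> * X \<omega> + B \<omega>) ^ k \<le> (norm (A \<omega> * X \<omega>) + norm (B \<omega>)) ^ k"
      by (intro power_mono norm_triangle_ineq) simp
    also have "\<dots> = (\<Sum>i\<le>k. of_nat (k choose i) * norm (X \<omega> ^ i * A \<omega> ^ i * B \<omega> ^ (k - i)))"
      by (simp add: binomial_ring norm_mult norm_power power_mult_distrib mult_ac)
    finally show ?thesis .
  qed
  then show "AE \<omega> in N. norm (norm (A \<omega> * X \<omega> + B \<omega>) ^ k) \<le>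
     norm (\<Sum>i\<le>k. of_nat (k choose i) * norm (X \<omega> ^ i * A \<omega> ^ i * B \<omega> ^ (k - i)))"
    by (intro AE_I2) (simp add: order_trans[OF _ abs_ge_self])
qed measurable

text \<open>In each binomial term \<open>X\<close> and \<open>A\<close> carry the same exponent
  \<open>i\<close> and the total order \<open>i + (k - i)\<close> is \<open>k\<close>, which is
  precisely the shape that affine independence factorizes.\<close>

lemma affinely_independent_moment_affine:
  assumes "affinely_independent N n X A B" "k \<le> n"
  shows "(\<integral>\<omega>. (A \<omega> * X \<omega> + B \<omega>) ^ k \<partial>N) =
    (\<Sum>i\<le>k. of_nat (k choose i) * ((\<integral>\<omega>. X \<omega> ^ i \<partial>N) * (\<integral>\<omega>. A \<omega> ^ i * B \<omega> ^ (k - i) \<partial>N)))"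
proof -
  have ai: "integrable N (\<lambda>\<omega>. X \<omega> ^ i * A \<omega> ^ i * B \<omega> ^ (k - i)) \<and>
      (\<integral>\<omega>. X \<omega> ^ i * A \<omega> ^ i * B \<omega> ^ (k - i) \<partial>N) =
      (\<integral>\<omega>. X \<omega> ^ i \<partial>N) * (\<integral>\<omega>. A \<omega> ^ i * B \<omega> ^ (k - i) \<partial>N)" if "i \<le> k" for i
    using assms that unfolding affinely_independent_def by simp
  have "(\<integral>\<omega>. (A \<omega> * X \<omega> + B \<omega>) ^ k \<partial>N) =
      (\<integral>\<omega>. (\<Sum>i\<le>k. of_nat (k choose i) * (X \<omega> ^ i * A \<omega> ^ i * B \<omega> ^ (k - i))) \<partial>N)"
    by (simp add: binomial_ring power_mult_distrib mult_ac)
  also have "\<dots> = (\<Sum>i\<le>k. \<integral>\<omega>. of_nat (k choose i) * (X \<omega> ^ i * A \<omega> ^ i * B \<omega> ^ (k - i)) \<partial>N)"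
    using ai by (intro Bochner_Integration.integral_sum) auto
  also have "\<dots> = (\<Sum>i\<le>k. of_nat (k choose i) *
      ((\<integral>\<omega>. X \<omega> ^ i \<partial>N) * (\<integral>\<omega>. A \<omega> ^ i * B \<omega> ^ (k - i) \<partial>N)))"
    using ai by (intro sum.cong refl) simp
  finally show ?thesis .
qed

lemma finite_moments_integrable_power:
  assumes "finite_moments N n X" "k \<le> n"
  shows "integrable N (\<lambda>\<omega>. X \<omega> ^ k)"
proof -
  have [measurable]: "X \<in> borel_measurable N" using assms by (simp add: finite_moments_def)
  have "integrable N (\<lambda>\<omega>. norm (X \<omega> ^ k))" using assms by (simp add: finite_moments_def norm_power)
  then show ?thesis by (subst (asm) integrable_norm_iff) auto
qed

text \<open>Shows that the polynomial depends on \<open>X\<close> through its moments alone.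
  Uniqueness compares these expansions, and existence reads off the coefficients.\<close>

lemma finite_moments_shift:
  assumes "finite_moments N n X"
  shows "(\<integral>\<omega>. (z - X \<omega>) ^ n \<partial>N) =
    (\<Sum>k\<le>n. of_nat (n choose k) * ((- 1) ^ k * (\<integral>\<omega>. X \<omega> ^ k \<partial>N)) * z ^ (n - k))"
proof -
  have "(z - X \<omega>) ^ n = (\<Sum>k\<le>n. of_nat (n choose k) * (- 1) ^ k * z ^ (n - k) * X \<omega> ^ k)" for \<omega>
    using binomial_ring[of "- X \<omega>" z n] by (simp add: power_minus[of "X \<omega>"] mult_ac)
  then have "(\<integral>\<omega>. (z - X \<omega>) ^ n \<partial>N) =
      (\<integral>\<omega>. (\<Sum>k\<le>n. of_nat (n choose k) * (- 1) ^ k * z ^ (n - k) * X \<omega> ^ k) \<partial>N)"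
    by simp
  also have "\<dots> = (\<Sum>k\<le>n. \<integral>\<omega>. of_nat (n choose k) * (- 1) ^ k * z ^ (n - k) * X \<omega> ^ k \<partial>N)"
    using finite_moments_integrable_power[OF assms] by (intro Bochner_Integration.integral_sum) auto
  also have "\<dots> = (\<Sum>k\<le>n. of_nat (n choose k) * ((- 1) ^ k * (\<integral>\<omega>. X \<omega> ^ k \<partial>N)) * z ^ (n - k))"
    by (simp add: mult_ac)
  finally show ?thesis .
qed

subsection \<open>Joint moments and product spaces\<close>

text \<open>A joint moment is the integral of a Borel function against the joint law, so a copy of
  the pair on another space has the same joint moments.\<close>

lemma joint_law_joint_moment:
  fixes M :: "'a measure" and N :: "'b measure"
  assumes [measurable]: "A \<in> borel_measurable M" "B \<in> borel_measurable M"
      "A' \<in> borel_measurable N" "B' \<in> borel_measurable N"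
    and law: "joint_law N A' B' = joint_law M A B"
  shows "(\<integral>\<omega>. A' \<omega> ^ i * B' \<omega> ^ j \<partial>N) = (\<integral>\<omega>. A \<omega> ^ i * B \<omega> ^ j \<partial>M)"
proof -
  let ?f = "\<lambda>t :: complex \<times> complex. fst t ^ i * snd t ^ j"
  have [measurable]: "?f \<in> borel_measurable borel"
    by (intro borel_measurable_continuous_onI continuous_intros)
  have "(\<integral>\<omega>. A' \<omega> ^ i * B' \<omega> ^ j \<partial>N) = integral\<^sup>L (joint_law N A' B') ?f"
    unfolding joint_law_def by (simp add: integral_distr)
  also have "\<dots> = (\<integral>\<omega>. A \<omega> ^ i * B \<omega> ^ j \<partial>M)"
    unfolding law unfolding joint_law_def by (simp add: integral_distr)
  finally show ?thesis .
qed

text \<open>An elementary substitute for Hoelder's inequality: with \<open>?c\<close> the maximum,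
  the product is at most a power of \<open>?c\<close> of order at most \<open>n\<close>, hence at
  most 1 or at most \<open>?c ^ n\<close>.\<close>

lemma power_mult_power_le:
  fixes a b :: real
  assumes "a \<ge> 0" "b \<ge> 0" "i + j \<le> n"
  shows "a ^ i * b ^ j \<le> 1 + a ^ n + b ^ n"
proof -
  let ?c = "max a b"
  have "a ^ i * b ^ j \<le> ?c ^ i * ?c ^ j"
    using assms by (intro mult_mono power_mono) auto
  also have "\<dots> = ?c ^ (i + j)" by (simp add: power_add)
  also have "\<dots> \<le> 1 + ?c ^ n"
  proof (cases "?c \<le> 1")
    case True
    then have "?c ^ (i + j) \<le> 1" using assms by (intro power_le_one) auto
    then show ?thesis using assms by (simp add: add_increasing2)
  next
    case False
    then have "?c ^ (i + j) \<le> ?c ^ n" using assms by (intro power_increasing) auto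
    then show ?thesis by simp
  qed
  also have "\<dots> \<le> 1 + a ^ n + b ^ n" using assms by (auto simp: max_def)
  finally show ?thesis .
qed

lemma (in finite_measure) integrable_joint_moment:
  fixes A B :: "'a \<Rightarrow> complex"
  assumes [measurable]: "A \<in> borel_measurable M" "B \<in> borel_measurable M"
    and "integrable M (\<lambda>\<omega>. norm (A \<omega>) ^ n)" "integrable M (\<lambda>\<omega>. norm (B \<omega>) ^ n)" "i + j \<le> n"
  shows "integrable M (\<lambda>\<omega>. A \<omega> ^ i * B \<omega> ^ j)"
proof (rule Bochner_Integration.integrable_bound)
  show "integrable M (\<lambda>\<omega>. 1 + norm (A \<omega>) ^ n + norm (B \<omega>) ^ n)" using assms by simp
  show "AE \<omega> in M. norm (A \<omega> ^ i * B \<omega> ^ j) \<le> norm (1 + norm (A \<omega>) ^ n + norm (B \<omega>) ^ n)"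
    using power_mult_power_le[OF norm_ge_zero norm_ge_zero \<open>i + j \<le> n\<close>]
    by (intro AE_I2) (simp add: norm_mult norm_power order_trans[OF _ abs_ge_self])
qed measurable

text \<open>Fubini for a product of functions of separate coordinates. With one factor constantly 1
  on a probability space it also gives the moments of a single coordinate.\<close>

lemma (in pair_sigma_finite) product_integrable:
  fixes f :: "'a \<Rightarrow> complex" and g :: "'b \<Rightarrow> complex"
  assumes f: "integrable M1 f" and g: "integrable M2 g"
  shows "integrable (M1 \<Otimes>\<^sub>M M2) (\<lambda>t. f (fst t) * g (snd t))" (is ?I)
    and "(\<integral>t. f (fst t) * g (snd t) \<partial>(M1 \<Otimes>\<^sub>M M2)) = (\<integral>x. f x \<partial>M1) * (\<integral>y. g y \<partial>M2)"
proof -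
  have [measurable]: "f \<in> borel_measurable M1" "g \<in> borel_measurable M2" using assms by auto
  show I: ?I
  proof (rule Fubini_integrable)
    show "integrable M1 (\<lambda>x. \<integral>y. norm (f (fst (x, y)) * g (snd (x, y))) \<partial>M2)"
      using f by (simp add: norm_mult)
    show "AE x in M1. integrable M2 (\<lambda>y. f (fst (x, y)) * g (snd (x, y)))"
      using g by simp
  qed measurable
  show "(\<integral>t. f (fst t) * g (snd t) \<partial>(M1 \<Otimes>\<^sub>M M2)) = (\<integral>x. f x \<partial>M1) * (\<integral>y. g y \<partial>M2)"
    using integral_fst'[OF I] by simp
qed

subsection \<open>Existence and uniqueness\<close>

context
  fixes M :: "'a measure" and A B :: "'a \<Rightarrow> complex" and n :: nat
  assumes M: "prob_space M"
    and meas [measurable]: "A \<in> borel_measurable M" "B \<in> borel_measurable M"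
    and ne1: "\<And>k. k \<in> {1..n} \<Longrightarrow> (\<integral>\<omega>. A \<omega> ^ k \<partial>M) \<noteq> 1"
begin

lemma perpetuity_realization_moment:
  assumes "perpetuity_realization N X A' B' M n A B p" "k \<le> n"
  shows "(\<integral>\<omega>. X \<omega> ^ k \<partial>N) = perpetuity_moment (\<lambda>i j. \<integral>\<omega>. A \<omega> ^ i * B \<omega> ^ j \<partial>M) k"
proof (rule perpetuity_moment_unique[of "\<lambda>k. \<integral>\<omega>. X \<omega> ^ k \<partial>N" n])
  note r = assms(1)[unfolded perpetuity_realization_def]
  interpret N: prob_space N using r by blast
  have jm: "(\<integral>\<omega>. A' \<omega> ^ i * B' \<omega> ^ j \<partial>N) = (\<integral>\<omega>. A \<omega> ^ i * B \<omega> ^ j \<partial>M)" for i j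
    using r by (intro joint_law_joint_moment) auto
  show "(\<integral>\<omega>. X \<omega> ^ 0 \<partial>N) = 1" by (simp add: N.prob_space)
  fix k assume k: "k \<in> {1..n}"
  then have "(\<integral>\<omega>. X \<omega> ^ k \<partial>N) = (\<integral>\<omega>. (A' \<omega> * X \<omega> + B' \<omega>) ^ k \<partial>N)"
    using r by (auto simp: moments_eq_def)
  then show "(\<integral>\<omega>. X \<omega> ^ k \<partial>N) =
      (\<Sum>i\<le>k. of_nat (k choose i) * ((\<integral>\<omega>. X \<omega> ^ i \<partial>N) * (\<integral>\<omega>. A \<omega> ^ i * B \<omega> ^ (k - i) \<partial>M)))"
    using affinely_independent_moment_affine[of N n X A' B' k] r k jm by simp
qed (use ne1 assms(2) in auto)

lemma finite_free_perpetuity_poly_unique: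
  assumes "finite_free_perpetuity_poly M n A B p" "finite_free_perpetuity_poly M n A B q"
  shows "p = q"
proof -
  have "poly p z = (\<Sum>k\<le>n. of_nat (n choose k) *
      ((- 1) ^ k * perpetuity_moment (\<lambda>i j. \<integral>\<omega>. A \<omega> ^ i * B \<omega> ^ j \<partial>M) k) * z ^ (n - k))"
    if p: "finite_free_perpetuity_poly M n A B p" for p z
  proof -
    obtain N :: "(complex \<times> complex \<times> complex) measure" and X A' B'
      where r: "perpetuity_realization N X A' B' M n A B p"
      using p unfolding finite_free_perpetuity_poly_def by blast
    then have "finite_moments N n X" "poly p z = (\<integral>\<omega>. (z - X \<omega>) ^ n \<partial>N)"
      by (auto simp: perpetuity_realization_def moments_eq_def)
    then show ?thesis
      by (simp add: finite_moments_shift perpetuity_realization_moment[OF r])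
  qed
  \<comment> \<open>The values of \<open>p\<close> and \<open>q\<close> agree everywhere, and over
    an infinite field a polynomial is determined by its values.\<close>
  then show ?thesis using assms by (simp add: poly_eq_poly_eq_iff[symmetric] fun_eq_iff)
qed

lemma finite_free_perpetuity_poly_exists:
  assumes "integrable M (\<lambda>\<omega>. norm (A \<omega>) ^ n)" "integrable M (\<lambda>\<omega>. norm (B \<omega>) ^ n)"
  shows "\<exists>p. finite_free_perpetuity_poly M n A B p"
proof -
  interpret M: prob_space M by (rule M)
  define E where "E i j = (\<integral>\<omega>. A \<omega> ^ i * B \<omega> ^ j \<partial>M)" for i j
  obtain D :: "nat measure" and X
    where D: "prob_space D" and fX: "finite_moments D n X"
      and X: "\<And>l. l \<le> n \<Longrightarrow> (\<integral>j. X j ^ l \<partial>D) = perpetuity_moment E l"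
    using exists_prob_space_moments[of "perpetuity_moment E" n] by auto
  interpret D: prob_space D by (rule D)
  interpret P: pair_prob_space M D ..
  have [measurable]: "X \<in> borel_measurable D" using fX by (simp add: finite_moments_def)
  let ?N = "M \<Otimes>\<^sub>M D" and ?X = "\<lambda>t. X (snd t)" and ?A = "\<lambda>t. A (fst t)" and ?B = "\<lambda>t. B (fst t)"
  have iX: "integrable D (\<lambda>j. X j ^ k)" if "k \<le> n" for k
    by (rule finite_moments_integrable_power[OF fX that])
  have iAB: "integrable M (\<lambda>\<omega>. A \<omega> ^ i * B \<omega> ^ j)" if "i + j \<le> n" for i j
    by (rule M.integrable_joint_moment[OF meas assms that])
  have X_mom: "integrable ?N (\<lambda>t. ?X t ^ k)" "(\<integral>t. ?X t ^ k \<partial>?N) = perpetuity_moment E k"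
    if "k \<le> n" for k
    using P.product_integrable[of "\<lambda>_. 1" "\<lambda>j. X j ^ k"] iX[OF that] X[OF that]
    by (simp_all add: M.prob_space)
  have AB_mom: "(\<integral>t. ?A t ^ i * ?B t ^ j \<partial>?N) = E i j" if "i + j \<le> n" for i j
    using P.product_integrable(2)[of "\<lambda>\<omega>. A \<omega> ^ i * B \<omega> ^ j" "\<lambda>_. 1"] iAB[OF that]
    by (simp add: D.prob_space E_def)
  have ai: "affinely_independent ?N n ?X ?A ?B"
    unfolding affinely_independent_def
  proof (intro allI impI)
    fix i j assume ij: "i + j \<le> n"
    then have "i \<le> n" by simp
    with ij show "integrable ?N (\<lambda>t. ?X t ^ i * ?A t ^ i * ?B t ^ j) \<and>
      (\<integral>t. ?X t ^ i * ?A t ^ i * ?B t ^ j \<partial>?N) =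
      (\<integral>t. ?X t ^ i \<partial>?N) * (\<integral>t. ?A t ^ i * ?B t ^ j \<partial>?N)"
      using P.product_integrable[OF iAB[OF ij] iX[OF \<open>i \<le> n\<close>]]
      by (simp add: X_mom AB_mom X mult_ac E_def[symmetric])
  qed
  have law: "joint_law ?N ?A ?B = joint_law M A B"
  proof -
    \<comment> \<open>The pair depends on the first coordinate only, whose marginal is
      \<open>M\<close> because \<open>D\<close> has total mass 1.\<close>
    have "distr (distr ?N M fst) borel (\<lambda>\<omega>. (A \<omega>, B \<omega>)) = joint_law ?N ?A ?B"
      unfolding joint_law_def by (subst distr_distr) (simp_all add: comp_def)
    moreover have "distr ?N M fst = M"
      by (rule D.distr_pair_fst)
    ultimately show ?thesis unfolding joint_law_def by simp
  qed
  have fX': "finite_moments ?N n ?X"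
    unfolding finite_moments_def using integrable_norm[OF X_mom(1)] by (auto simp: norm_power)
  have "moments_eq ?N n ?X (\<lambda>t. ?A t * ?X t + ?B t)"
    unfolding moments_eq_def
  proof (intro conjI ballI)
    show "finite_moments ?N n (\<lambda>t. ?A t * ?X t + ?B t)"
      unfolding finite_moments_def using affinely_independent_integrable_affine[OF ai] by auto
    fix k assume k: "k \<in> {1..n}"
    then have "(\<integral>t. (?A t * ?X t + ?B t) ^ k \<partial>?N) =
        (\<Sum>i\<le>k. of_nat (k choose i) * (perpetuity_moment E i * E i (k - i)))"
      by (simp add: affinely_independent_moment_affine[OF ai] X_mom AB_mom)
    \<comment> \<open>Here the assumption on the moments of \<open>A\<close> enters: it makes the
      chosen sequence a genuine solution of the moment equation.\<close>
    also have "\<dots> = perpetuity_moment E k"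
      using k ne1[OF k] by (intro perpetuity_moment_recursion[symmetric]) (auto simp: E_def)
    also have "\<dots> = (\<integral>t. ?X t ^ k \<partial>?N)" using k by (simp add: X_mom)
    finally show "(\<integral>t. ?X t ^ k \<partial>?N) = (\<integral>t. (?A t * ?X t + ?B t) ^ k \<partial>?N)" ..
  qed (rule fX')
  moreover define p where
    "p = (\<Sum>k\<le>n. monom (of_nat (n choose k) * ((- 1) ^ k * (\<integral>t. ?X t ^ k \<partial>?N))) (n - k))"
  have "poly p z = (\<integral>t. (z - ?X t) ^ n \<partial>?N)" for z
    by (simp add: finite_moments_shift[OF fX'] p_def poly_sum poly_monom)
  ultimately have "perpetuity_realization ?N ?X ?A ?B M n A B p"
    unfolding perpetuity_realization_def using law ai by (auto intro: P.prob_space_axioms)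
  \<comment> \<open>The realization lives on pairs of a point of \<open>M\<close> and a natural
    number; passing to the law of the triple moves it to the sample type fixed in the
    definition.\<close>
  then show ?thesis using finite_free_perpetuity_polyI by blast
qed

end

theorem theorem5p4:
  fixes M :: "'a measure" and A B :: "'a \<Rightarrow> complex" and n :: nat
  assumes "prob_space M"
    and "n \<ge> 1"
    and "A \<in> borel_measurable M" and "B \<in> borel_measurable M"
    and "integrable M (\<lambda>\<omega>. norm (A \<omega>) ^ n)"
    and "integrable M (\<lambda>\<omega>. norm (B \<omega>) ^ n)"
    and "\<And>k. k \<in> {1..n} \<Longrightarrow> (\<integral>\<omega>. A \<omega> ^ k \<partial>M) \<noteq> 1"
  shows "\<exists>!p :: complex poly. finite_free_perpetuity_poly M n A B p"
  using finite_free_perpetuity_poly_exists[OF assms(1,3,4,7,5,6)]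
    finite_free_perpetuity_poly_unique[OF assms(1,3,4,7)]
  by blast

end
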